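(* Let $a>-1$ and $b>-1$ be real numbers, at least one of them being positive, and let $D=a+b+2$. Then there exists a constant $C$ depending only on $a$ and $b$ such that for every bounded domain $\widetilde U\subset(\mathbb R_+)^2$ satisfying property (P) (defined in the context), $$m(\widetilde U)^{\frac{D-1}{D}}\leq C\,m\big(\partial\widetilde U\cap(\mathbb R_+)^2\big).$$
   Context: $(\mathbb R_+)^2=(0,\infty)^2$ with coordinates $(\sigma,\tau)$. Property (P): for all $(\sigma,\tau)\in\widetilde U$, the slices $\widetilde U(\cdot,\tau):=\{\sigma'>0:\ (\sigma',\tau)\in\widetilde U\}$ and $\widetilde U(\sigma,\cdot):=\{\tau'>0:\ (\sigma,\tau')\in\widetilde U\}$ are intervals which are strictly decreasing in $\tau$ and $\sigma$, respectively. Here "strictly decreasing" is with respect to inclusion: if $0<\tau_1<\tau_2$ and $\widetilde U(\cdot,\tau_2)\neq\emptyset$, then $\widetilde U(\cdot,\tau_2)\subsetneq\widetilde U(\cdot,\tau_1)$; and if $0<\sigma_1<\sigma_2$ and $\widetilde U(\sigma_2,\cdot)\neq\emptyset$, then $\widetilde U(\sigma_2,\cdot)\subsetneq\widetilde U(\sigma_1,\cdot)$. No further regularity is assumed on $\widetilde U$. Weighted area and perimeter: $$m(\widetilde U)=\int_{\widetilde U}\sigma^a\tau^b\,d\sigma\,d\tau,\qquad m\big(\partial\widetilde U\cap(\mathbb R_+)^2\big)=\int_{\partial\widetilde U\cap(\mathbb R_+)^2}\sigma^a\tau^b\,d\mathcal H^1,$$ where $\mathcal H^1$ is arclength (one-dimensional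 Hausdorff measure). The part of $\partial\widetilde U$ lying on the coordinate axes is not counted in the weighted perimeter. *)

theory Defs
  imports "HOL-Analysis.Analysis"
begin

section \<open>One-dimensional Hausdorff measure\<close>

text \<open>
  Size-\<open>\<delta>\<close> approximation: the infimum of the sums of diameters over all countable covers by sets of
  diameter at most \<open>\<delta>\<close>. Boundedness is required explicitly because \<^const>\<open>diameter\<close> is
  unspecified on unbounded sets. With this normalisation the measure of a rectifiable arc is its
  length. For pairs of reals, \<^const>\<open>dist\<close> is the Euclidean distance.
\<close>

definition hausdorff1_pre :: "real \<Rightarrow> 'a::metric_space set \<Rightarrow> ennreal" where
  "hausdorff1_pre \<delta> A =
     (INF E \<in> {E :: nat \<Rightarrow> 'a set. A \<subseteq> (\<Union>i. E i) \<and> (\<forall>i. bounded (E i) \<and> diameter (E i) \<le> \<delta>)}.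
        \<Sum>i. ennreal (diameter (E i)))"

definition hausdorff1_outer :: "'a::metric_space set \<Rightarrow> ennreal" where
  "hausdorff1_outer A = (SUP \<delta>\<in>{0<..}. hausdorff1_pre \<delta> A)"

definition hausdorff1 :: "'a::metric_space measure" where
  "hausdorff1 = measure_of UNIV (sets borel) hausdorff1_outer"

text \<open>
  Since \<^const>\<open>measure_of\<close> returns the zero measure when given a set function that is not a
  measure, we check that the outer measure above is countably additive on the Borel sets
  (lemma \<open>emeasure_hausdorff1\<close> below).
\<close>

lemma hausdorff1_pre_mono: "A \<subseteq> B \<Longrightarrow> hausdorff1_pre \<delta> A \<le> hausdorff1_pre \<delta> B"
  unfolding hausdorff1_pre_def by (intro INF_superset_mono) auto

lemma hausdorff1_pre_antimono: "\<delta> \<le> \<epsilon> \<Longrightarrow> hausdorff1_pre \<epsilon> A \<le> hausdorff1_pre \<delta> A"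
  unfolding hausdorff1_pre_def by (intro INF_superset_mono) (auto intro: order_trans)

lemma hausdorff1_pre_empty: "0 < \<delta> \<Longrightarrow> hausdorff1_pre \<delta> {} = 0"
proof -
  assume "0 < \<delta>"
  then have "hausdorff1_pre \<delta> ({} :: 'a set) \<le> (\<Sum>i::nat. ennreal (diameter ({} :: 'a set)))"
    unfolding hausdorff1_pre_def by (intro INF_lower) auto
  then show ?thesis by simp
qed

lemma hausdorff1_outer_mono: "A \<subseteq> B \<Longrightarrow> hausdorff1_outer A \<le> hausdorff1_outer B"
  unfolding hausdorff1_outer_def by (intro SUP_mono) (auto intro: hausdorff1_pre_mono)

lemma hausdorff1_pre_le_outer: "0 < \<delta> \<Longrightarrow> hausdorff1_pre \<delta> A \<le> hausdorff1_outer A"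
  unfolding hausdorff1_outer_def by (intro SUP_upper) auto

lemma hausdorff1_outer_empty: "hausdorff1_outer {} = 0"
  unfolding hausdorff1_outer_def by (simp add: hausdorff1_pre_empty)

lemma hausdorff1_pre_countably_subadditive:
  fixes A :: "nat \<Rightarrow> 'a::metric_space set"
  shows "hausdorff1_pre \<delta> (\<Union>n. A n) \<le> (\<Sum>n. hausdorff1_pre \<delta> (A n))"
proof (rule ennreal_le_epsilon)
  fix e :: real
  assume e: "0 < e" and fin: "(\<Sum>n. hausdorff1_pre \<delta> (A n)) < top"
  then have lt: "hausdorff1_pre \<delta> (A n) < hausdorff1_pre \<delta> (A n) + e * (1/2)^Suc n" for n
    by (auto simp add: less_top dest!: ennreal_suminf_lessD)
  have "\<exists>E. A n \<subseteq> (\<Union>i. E i) \<and> (\<forall>i. bounded (E i) \<and> diameter (E i) \<le> \<delta>) \<and>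
      (\<Sum>i. ennreal (diameter (E i))) \<le> hausdorff1_pre \<delta> (A n) + e * (1/2)^Suc n" for n
    using lt[of n] unfolding hausdorff1_pre_def[of \<delta> "A n"] INF_less_iff
    by (auto intro: less_imp_le)
  then obtain B where sub: "\<And>n. A n \<subseteq> (\<Union>i. B n i)"
    and bd: "\<And>n i. bounded (B n i)" "\<And>n i. diameter (B n i) \<le> \<delta>"
    and le: "\<And>n. (\<Sum>i. ennreal (diameter (B n i))) \<le> hausdorff1_pre \<delta> (A n) + e * (1/2)^Suc n"
    by metis
  define C where "C = case_prod B o prod_decode"
  have AC: "(\<Union>n. A n) \<subseteq> (\<Union>i. C i)"
    using sub by (auto simp add: C_def subset_eq) (metis prod.case prod_encode_inverse)
  have "hausdorff1_pre \<delta> (\<Union>n. A n) \<le> (\<Sum>i. ennreal (diameter (C i)))"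
    unfolding hausdorff1_pre_def using AC bd
    by (intro INF_lower) (auto simp: C_def split: prod.split)
  also have "\<dots> = (\<Sum>i. (\<lambda>p. ennreal (diameter (case_prod B p))) (prod_decode i))"
    by (simp add: C_def)
  also have "\<dots> = (\<Sum>n. \<Sum>i. ennreal (diameter (B n i)))"
    by (intro suminf_ennreal_2dimen) auto
  also have "\<dots> \<le> (\<Sum>n. hausdorff1_pre \<delta> (A n) + e * (1/2) ^ Suc n)"
    by (intro suminf_le allI le) auto
  also have "... = (\<Sum>n. hausdorff1_pre \<delta> (A n)) + (\<Sum>n. ennreal e * ennreal ((1/2) ^ Suc n))"
    using \<open>0 < e\<close> by (subst suminf_add[symmetric])
                     (auto simp del: ennreal_suminf_cmult simp add: ennreal_mult[symmetric])
  also have "\<dots> = (\<Sum>n. hausdorff1_pre \<delta> (A n)) + e"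
    unfolding ennreal_suminf_cmult
    by (subst suminf_ennreal_eq[OF zero_le_power power_half_series]) auto
  finally show "hausdorff1_pre \<delta> (\<Union>n. A n) \<le> (\<Sum>n. hausdorff1_pre \<delta> (A n)) + e" .
qed

lemma hausdorff1_outer_countably_subadditive:
  fixes A :: "nat \<Rightarrow> 'a::metric_space set"
  shows "hausdorff1_outer (\<Union>n. A n) \<le> (\<Sum>n. hausdorff1_outer (A n))"
  unfolding hausdorff1_outer_def[of "\<Union>n. A n"]
proof (rule SUP_least)
  fix \<delta> :: real assume "\<delta> \<in> {0<..}"
  then have "(\<Sum>n. hausdorff1_pre \<delta> (A n)) \<le> (\<Sum>n. hausdorff1_outer (A n))"
    by (intro suminf_le) (auto intro: hausdorff1_pre_le_outer)
  with hausdorff1_pre_countably_subadditive[of \<delta> A]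
  show "hausdorff1_pre \<delta> (\<Union>n. A n) \<le> (\<Sum>n. hausdorff1_outer (A n))" by (rule order_trans)
qed

lemma outer_measure_space_hausdorff1: "outer_measure_space (Pow UNIV) hausdorff1_outer"
  unfolding outer_measure_space_def positive_def increasing_def countably_subadditive_def
  by (auto simp: hausdorff1_outer_empty
      intro: hausdorff1_outer_mono hausdorff1_outer_countably_subadditive)

lemma hausdorff1_outer_Un: "hausdorff1_outer (A \<union> B) \<le> hausdorff1_outer A + hausdorff1_outer B"
proof -
  have "hausdorff1_outer (\<Union>n. binaryset A B n) \<le> (\<Sum>n. hausdorff1_outer (binaryset A B n))"
    by (rule hausdorff1_outer_countably_subadditive)
  then show ?thesis
    by (simp add: UN_binaryset_eq suminf_binaryset_eq hausdorff1_outer_empty)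
qed

lemma hausdorff1_pre_separated:
  fixes A B :: "'a::metric_space set"
  assumes sep: "\<And>x y. x \<in> A \<Longrightarrow> y \<in> B \<Longrightarrow> \<delta> < dist x y" and "0 < \<delta>"
  shows "hausdorff1_pre \<delta> A + hausdorff1_pre \<delta> B \<le> hausdorff1_pre \<delta> (A \<union> B)"
  unfolding hausdorff1_pre_def[of \<delta> "A \<union> B"]
proof (safe intro!: INF_greatest)
  fix E :: "nat \<Rightarrow> 'a set"
  assume cov: "A \<union> B \<subseteq> (\<Union>i. E i)" and E: "\<forall>i. bounded (E i) \<and> diameter (E i) \<le> \<delta>"
  define F where "F = (\<lambda>i. if E i \<inter> A = {} then {} else E i)"
  define G where "G = (\<lambda>i. if E i \<inter> A = {} then E i else {})"
  have "A \<subseteq> (\<Union>i. F i)" using cov by (force simp: F_def)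
  then have F: "hausdorff1_pre \<delta> A \<le> (\<Sum>i. ennreal (diameter (F i)))"
    unfolding hausdorff1_pre_def using E \<open>0 < \<delta>\<close> by (intro INF_lower) (auto simp: F_def)
  have "B \<subseteq> (\<Union>i. G i)"
  proof
    fix y assume y: "y \<in> B"
    then obtain i where i: "y \<in> E i" using cov by auto
    have "x \<notin> A" if "x \<in> E i" for x
      using diameter_bounded_bound[of "E i" x y] sep[of x y] E i y that by (force dest: spec[of _ i])
    then show "y \<in> (\<Union>i. G i)" using i by (auto simp: G_def)
  qed
  then have G: "hausdorff1_pre \<delta> B \<le> (\<Sum>i. ennreal (diameter (G i)))"
    unfolding hausdorff1_pre_def using E \<open>0 < \<delta>\<close> by (intro INF_lower) (auto simp: G_def)
  have "(\<Sum>i. ennreal (diameter (F i))) + (\<Sum>i. ennreal (diameter (G i)))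
      = (\<Sum>i. ennreal (diameter (F i)) + ennreal (diameter (G i)))"
    by (rule suminf_add) auto
  also have "\<dots> = (\<Sum>i. ennreal (diameter (E i)))"
    by (intro suminf_cong) (auto simp: F_def G_def)
  finally show "hausdorff1_pre \<delta> A + hausdorff1_pre \<delta> B \<le> (\<Sum>i. ennreal (diameter (E i)))"
    using add_mono[OF F G] by simp
qed

lemma hausdorff1_outer_separated:
  fixes A B :: "'a::metric_space set"
  assumes sep: "\<And>x y. x \<in> A \<Longrightarrow> y \<in> B \<Longrightarrow> r \<le> dist x y" and "0 < r"
  shows "hausdorff1_outer (A \<union> B) = hausdorff1_outer A + hausdorff1_outer B"
proof (rule antisym[OF hausdorff1_outer_Un])
  have "hausdorff1_pre \<delta> A + hausdorff1_pre \<epsilon> B \<le> hausdorff1_outer (A \<union> B)"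
    if "0 < \<delta>" "0 < \<epsilon>" for \<delta> \<epsilon>
  proof -
    define \<eta> where "\<eta> = min (min \<delta> \<epsilon>) (r/2)"
    have \<eta>: "0 < \<eta>" "\<eta> \<le> \<delta>" "\<eta> \<le> \<epsilon>" "\<eta> < r" using that \<open>0 < r\<close> by (auto simp: \<eta>_def)
    have "hausdorff1_pre \<delta> A + hausdorff1_pre \<epsilon> B \<le> hausdorff1_pre \<eta> A + hausdorff1_pre \<eta> B"
      by (intro add_mono hausdorff1_pre_antimono \<eta>)
    also have "\<dots> \<le> hausdorff1_pre \<eta> (A \<union> B)"
      using sep \<eta> by (intro hausdorff1_pre_separated) (force intro: less_le_trans)+
    also have "\<dots> \<le> hausdorff1_outer (A \<union> B)"
      by (rule hausdorff1_pre_le_outer[OF \<eta>(1)])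
    finally show ?thesis .
  qed
  then show "hausdorff1_outer A + hausdorff1_outer B \<le> hausdorff1_outer (A \<union> B)"
    unfolding hausdorff1_outer_def[of A] hausdorff1_outer_def[of B]
    by (auto simp: ennreal_SUP_add_left[symmetric] ennreal_SUP_add_right intro!: SUP_least)
qed

lemma closed_in_lambda_system_hausdorff1:
  fixes F :: "'a::metric_space set"
  assumes "closed F" "F \<noteq> {}"
  shows "F \<in> lambda_system UNIV (Pow UNIV) hausdorff1_outer"
proof -
  have main: "hausdorff1_outer (T \<inter> F) + hausdorff1_outer (T - F) \<le> hausdorff1_outer T" for T
  proof (rule ennreal_le_epsilon)
    fix e :: real
    assume "0 < e" and fin: "hausdorff1_outer T < top"
    define c where "c n = inverse (real (Suc n))" for n
    define d where "d x = infdist x F" for x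
    have c_dec: "c m < c n" if "n < m" for m n
      using that by (simp add: c_def field_simps)
    have c_le: "c m \<le> c n" if "n \<le> m" for m n
      using that c_dec[of n m] by (cases "n = m") auto
    have c_pos: "0 < c n" for n by (simp add: c_def)
    have d_lip: "\<bar>d x - d y\<bar> \<le> dist x y" for x y
      unfolding d_def by (rule infdist_triangle_abs)
    have d0: "d x = 0" if "x \<in> F" for x using that by (simp add: d_def)
    have dpos: "0 < d x" if "x \<notin> F" for x
      using that assms by (simp add: d_def infdist_pos_not_in_closed)
    define A where "A n = {x \<in> T. c n \<le> d x}" for n
    define B where "B n = {x \<in> T. c (Suc n) \<le> d x \<and> d x < c n}" for n
    have part: "(\<Sum>k<n. hausdorff1_outer (B (2 * k + p))) \<le> hausdorff1_outer T" for n p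
    proof -
      have "(\<Sum>k<n. hausdorff1_outer (B (2 * k + p))) = hausdorff1_outer (\<Union>k<n. B (2 * k + p))"
      proof (induction n)
        case 0
        then show ?case by (simp add: hausdorff1_outer_empty)
      next
        case (Suc n)
        have "hausdorff1_outer ((\<Union>k<n. B (2 * k + p)) \<union> B (2 * n + p))
            = hausdorff1_outer (\<Union>k<n. B (2 * k + p)) + hausdorff1_outer (B (2 * n + p))"
        proof (cases n)
          case 0
          then show ?thesis by (simp add: hausdorff1_outer_empty)
        next
          case (Suc m)
          show ?thesis
          proof (rule hausdorff1_outer_separated)
            show "0 < c (2 * m + p + 1) - c (2 * n + p)"
              using c_dec[of "2 * m + p + 1" "2 * n + p"] Suc by simp
            fix x y assume "x \<in> (\<Union>k<n. B (2 * k + p))" and y: "y \<in> B (2 * n + p)"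
            then obtain k where k: "k \<le> m" "x \<in> B (2 * k + p)"
              using Suc by (auto simp: less_Suc_eq_le)
            then have "c (2 * m + p + 1) \<le> d x"
              using c_le[of "Suc (2 * k + p)" "2 * m + p + 1"] by (auto simp: B_def)
            moreover have "d y < c (2 * n + p)" using y by (auto simp: B_def)
            ultimately show "c (2 * m + p + 1) - c (2 * n + p) \<le> dist x y"
              using d_lip[of x y] by linarith
          qed
        qed
        then show ?case using Suc by (simp add: lessThan_Suc Un_commute)
      qed
      also have "\<dots> \<le> hausdorff1_outer T"
        by (intro hausdorff1_outer_mono) (auto simp: B_def)
      finally show ?thesis .
    qed
    have "(\<Sum>k<n. hausdorff1_outer (B k)) \<le> hausdorff1_outer T + hausdorff1_outer T" for n
    proof -
      have "(\<Sum>k<n. hausdorff1_outer (B k)) \<le> (\<Sum>k<2 * n. hausdorff1_outer (B k))"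
        by (intro sum_mono2) auto
      also have "\<dots> = (\<Sum>k<n. hausdorff1_outer (B (2 * k + 0)))
          + (\<Sum>k<n. hausdorff1_outer (B (2 * k + 1)))"
        by (induction n) (auto simp: algebra_simps)
      also have "\<dots> \<le> hausdorff1_outer T + hausdorff1_outer T"
        by (intro add_mono part)
      finally show ?thesis .
    qed
    then have "(\<Sum>k. hausdorff1_outer (B k)) \<le> hausdorff1_outer T + hausdorff1_outer T"
      by (intro suminf_le_const) auto
    then have sfin: "(\<Sum>k. hausdorff1_outer (B k)) < top"
      by (rule le_less_trans) (use fin in simp)
    have "\<exists>n. (\<Sum>k. hausdorff1_outer (B (k + n))) \<le> e"
    proof -
      have split: "(\<Sum>k. hausdorff1_outer (B k))
          = (\<Sum>k<n. hausdorff1_outer (B k)) + (\<Sum>k. hausdorff1_outer (B (k + n)))" for n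
        by (subst suminf_offset[of _ n]) (auto simp: add.commute)
      have "(\<Sum>k. hausdorff1_outer (B k)) \<le> 0 \<or>
          (\<exists>n. (\<Sum>k. hausdorff1_outer (B k)) \<le> (\<Sum>k<n. hausdorff1_outer (B k)) + e)"
      proof (rule ccontr)
        assume no: "\<not> ?thesis"
        then have gt: "(\<Sum>k<n. hausdorff1_outer (B k)) + e \<le> (\<Sum>k. hausdorff1_outer (B k))" for n
          by (auto simp: not_le less_imp_le)
        have "(\<Sum>k. hausdorff1_outer (B k)) + e = (SUP n. (\<Sum>k<n. hausdorff1_outer (B k)) + e)"
          unfolding suminf_eq_SUP by (subst ennreal_SUP_add_left) auto
        also have "\<dots> \<le> (\<Sum>k. hausdorff1_outer (B k))"
          by (intro SUP_least gt)
        finally have "(\<Sum>k. hausdorff1_outer (B k)) + e \<le> (\<Sum>k. hausdorff1_outer (B k)) + 0"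
          by simp
        then have "ennreal e \<le> 0"
          using sfin by (subst (asm) ennreal_add_left_cancel_le) auto
        then show False using \<open>0 < e\<close> by simp
      qed
      then obtain n where
        "(\<Sum>k. hausdorff1_outer (B k)) \<le> (\<Sum>k<n. hausdorff1_outer (B k)) + ennreal e"
        by (auto intro: order_trans)
      then have "(\<Sum>k<n. hausdorff1_outer (B k)) + (\<Sum>k. hausdorff1_outer (B (k + n)))
          \<le> (\<Sum>k<n. hausdorff1_outer (B k)) + ennreal e"
        using split[of n] by simp
      moreover have "(\<Sum>k<n. hausdorff1_outer (B k)) \<noteq> top"
        using sfin split[of n] by (auto simp: less_top)
      ultimately show ?thesis
        by (auto simp: ennreal_add_left_cancel_le)
    qed
    then obtain n where n: "(\<Sum>k. hausdorff1_outer (B (k + n))) \<le> e" by auto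
    have "T - F \<subseteq> A n \<union> (\<Union>k. B (k + n))"
    proof
      fix x assume x: "x \<in> T - F"
      then have "0 < d x" using dpos by auto
      then obtain N where N: "c N < d x" unfolding c_def using reals_Archimedean by blast
      show "x \<in> A n \<union> (\<Union>k. B (k + n))"
      proof (cases "c n \<le> d x")
        case True
        then show ?thesis using x by (auto simp: A_def)
      next
        case False
        define m where "m = (LEAST m. c m \<le> d x)"
        have m: "c m \<le> d x" unfolding m_def by (rule LeastI[of "\<lambda>m. c m \<le> d x" N]) (use N in simp)
        have "n < m"
          using m False c_le[of m n] by (cases "m \<le> n") auto
        then obtain k where k: "m = Suc (k + n)" by (metis add.commute less_imp_Suc_add)
        then have "k + n < m" by simp
        then have "\<not> c (k + n) \<le> d x"
          unfolding m_def by (rule not_less_Least)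
        then have "x \<in> B (k + n)" using m k x by (auto simp: B_def)
        then show ?thesis by blast
      qed
    qed
    then have "hausdorff1_outer (T - F) \<le> hausdorff1_outer (A n \<union> (\<Union>k. B (k + n)))"
      by (rule hausdorff1_outer_mono)
    also have "\<dots> \<le> hausdorff1_outer (A n) + hausdorff1_outer (\<Union>k. B (k + n))"
      by (rule hausdorff1_outer_Un)
    also have "\<dots> \<le> hausdorff1_outer (A n) + e"
      by (intro add_left_mono order_trans[OF hausdorff1_outer_countably_subadditive n])
    finally have "hausdorff1_outer (T \<inter> F) + hausdorff1_outer (T - F)
        \<le> hausdorff1_outer (T \<inter> F) + hausdorff1_outer (A n) + e"
      by (simp add: add.assoc add_left_mono)
    also have "hausdorff1_outer (T \<inter> F) + hausdorff1_outer (A n) = hausdorff1_outer (T \<inter> F \<union> A n)"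
    proof (rule hausdorff1_outer_separated[symmetric, OF _ c_pos[of n]])
      fix x y assume "x \<in> T \<inter> F" "y \<in> A n"
      then show "c n \<le> dist x y" using d_lip[of x y] d0[of x] by (auto simp: A_def)
    qed
    also have "\<dots> \<le> hausdorff1_outer T"
      by (intro hausdorff1_outer_mono) (auto simp: A_def)
    finally show "hausdorff1_outer (T \<inter> F) + hausdorff1_outer (T - F) \<le> hausdorff1_outer T + e"
      by (simp add: add_right_mono)
  qed
  have "hausdorff1_outer (T \<inter> F) + hausdorff1_outer (T - F) = hausdorff1_outer T" for T
    using hausdorff1_outer_Un[of "T \<inter> F" "T - F"] main[of T]
    by (intro antisym) (auto simp: Int_Diff_Un)
  then show ?thesis
    unfolding algebra.lambda_system_eq[OF algebra_Pow] by simp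
qed

lemma measure_space_hausdorff1:
  "measure_space UNIV (sets (borel :: 'a::metric_space measure)) hausdorff1_outer"
proof -
  let ?L = "lambda_system UNIV (Pow (UNIV :: 'a set)) hausdorff1_outer"
  have L: "measure_space UNIV ?L hausdorff1_outer"
    by (intro sigma_algebra.caratheodory_lemma sigma_algebra_Pow outer_measure_space_hausdorff1)
  then interpret L: sigma_algebra UNIV ?L by (simp add: measure_space_def)
  have "sigma_sets UNIV (Collect closed) \<subseteq> ?L"
    by (intro L.sigma_sets_subset) (use closed_in_lambda_system_hausdorff1 L.empty_sets in blast)
  then have sub: "sets borel \<subseteq> ?L"
    by (simp add: borel_eq_closed sets_measure_of)
  have "sigma_algebra UNIV (sets (borel :: 'a measure))"
    using sets.sigma_algebra_axioms[of "borel :: 'a measure"] by simp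
  with L sub show ?thesis
    by (auto simp: measure_space_def positive_def countably_additive_def subset_eq image_subset_iff)
qed

lemma sets_hausdorff1 [simp, measurable_cong]: "sets hausdorff1 = sets borel"
  unfolding hausdorff1_def using sets.sigma_sets_eq[of borel] by (simp add: sets_measure_of)

lemma space_hausdorff1 [simp]: "space hausdorff1 = UNIV"
  unfolding hausdorff1_def by (simp add: space_measure_of)

lemma emeasure_hausdorff1: "A \<in> sets borel \<Longrightarrow> emeasure hausdorff1 A = hausdorff1_outer A"
  using measure_space_hausdorff1
  by (intro emeasure_measure_of[OF hausdorff1_def]) (auto simp: measure_space_def)


section \<open>Weighted area and perimeter\<close>

abbreviation pos_quadrant :: "(real \<times> real) set" where
  "pos_quadrant \<equiv> {0<..} \<times> {0<..}"

text \<open>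
  Both quantities take values in \<open>[0,\<infinity>]\<close>. The perimeter may be infinite: if an exponent is
  negative, the weight need not be integrable along the boundary.
\<close>

definition weight :: "real \<Rightarrow> real \<Rightarrow> real \<times> real \<Rightarrow> ennreal" where
  "weight a b = (\<lambda>(\<sigma>, \<tau>). ennreal (\<sigma> powr a * \<tau> powr b))"

definition weighted_area :: "real \<Rightarrow> real \<Rightarrow> (real \<times> real) set \<Rightarrow> ennreal" where
  "weighted_area a b U = (\<integral>\<^sup>+ p \<in> U. weight a b p \<partial>lborel)"

definition weighted_perimeter :: "real \<Rightarrow> real \<Rightarrow> (real \<times> real) set \<Rightarrow> ennreal" where
  "weighted_perimeter a b U = (\<integral>\<^sup>+ p \<in> frontier U \<inter> pos_quadrant. weight a b p \<partial>hausdorff1)"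

text \<open>Power on \<open>[0,\<infinity>]\<close> with exponent \<open>p > 0\<close>, so that the value at \<open>\<infinity>\<close> is \<open>\<infinity>\<close>.\<close>

definition ennreal_powr :: "ennreal \<Rightarrow> real \<Rightarrow> ennreal" where
  "ennreal_powr x p = (if x = \<infinity> then \<infinity> else ennreal (enn2real x powr p))"


section \<open>Property (P)\<close>

definition slice_fst :: "(real \<times> real) set \<Rightarrow> real \<Rightarrow> real set" where
  "slice_fst U \<tau> = {\<sigma>. 0 < \<sigma> \<and> (\<sigma>, \<tau>) \<in> U}"

definition slice_snd :: "(real \<times> real) set \<Rightarrow> real \<Rightarrow> real set" where
  "slice_snd U \<sigma> = {\<tau>. 0 < \<tau> \<and> (\<sigma>, \<tau>) \<in> U}"

definition property_P :: "(real \<times> real) set \<Rightarrow> bool" where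
  "property_P U \<longleftrightarrow>
     (\<forall>(\<sigma>, \<tau>) \<in> U. is_interval (slice_fst U \<tau>) \<and> is_interval (slice_snd U \<sigma>)) \<and>
     (\<forall>\<tau>1 \<tau>2. 0 < \<tau>1 \<longrightarrow> \<tau>1 < \<tau>2 \<longrightarrow> slice_fst U \<tau>2 \<noteq> {} \<longrightarrow> slice_fst U \<tau>2 \<subset> slice_fst U \<tau>1) \<and>
     (\<forall>\<sigma>1 \<sigma>2. 0 < \<sigma>1 \<longrightarrow> \<sigma>1 < \<sigma>2 \<longrightarrow> slice_snd U \<sigma>2 \<noteq> {} \<longrightarrow> slice_snd U \<sigma>2 \<subset> slice_snd U \<sigma>1)"

end

theory Submission
  imports Defs
begin

text \<open>
  Property (P) says that \<open>U\<close> is the region below the graph of a function \<open>h\<close> whose graph has no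
  vertical or horizontal pieces: \<open>(\<sigma>, \<tau>) \<in> U\<close> iff \<open>0 < \<tau> < h(\<sigma>)\<close>, the set \<open>U\<close> contains with each
  point the whole rectangle towards the origin, and over each \<open>\<sigma>\<close> the only possible frontier point
  in the open quadrant is \<open>(\<sigma>, h(\<sigma>))\<close> (lemma \<open>frontier_height_eq\<close>). Projections to the axes do not
  increase the one-dimensional Hausdorff measure, so the perimeter \<open>P\<close> satisfies
  \<open>\<integral> \<sigma>\<^sup>a h(\<sigma>)\<^sup>b d\<sigma> \<le> P\<close> (lemma \<open>nn_integral_height_le_weighted_perimeter\<close>), and likewise with the
  coordinates exchanged.

  Let \<open>(s, s)\<close> be the point where the diagonal leaves \<open>U\<close>, and assume \<open>b \<ge> 0\<close>.
  The part of \<open>U\<close> with \<open>\<tau> < s\<close> has area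
  \<open>\<integral> \<sigma>\<^sup>a min(s, h)\<^bsup>b+1\<^esup> / (b+1) d\<sigma> \<le> s P / (b+1)\<close>, and the part with \<open>\<tau> \<ge> s\<close> has width at most \<open>s\<close>,
  so that, slicing it horizontally, its area is at most \<open>s P / (a+1)\<close>. Hence \<open>m(U) \<le> K s P\<close> with
  \<open>K = 1/(a+1) + 1/(b+1)\<close>. On the other hand \<open>U\<close> contains the square \<open>(0, s)\<^sup>2\<close>, whose area is
  \<open>s\<^sup>D / ((a+1)(b+1))\<close>, so \<open>s \<le> ((a+1)(b+1) m(U))\<^bsup>1/D\<^esup>\<close>. Substituting this bound for \<open>s\<close> gives the
  isoperimetric inequality; the case \<open>a > 0\<close> follows by exchanging the coordinates.
\<close>

section \<open>Lipschitz images and one-dimensional Hausdorff measure\<close>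

lemma hausdorff1_outer_lipschitz_image:
  fixes f :: "'a::metric_space \<Rightarrow> 'b::metric_space"
  assumes lip: "\<And>x y. dist (f x) (f y) \<le> dist x y"
  shows "hausdorff1_outer (f ` A) \<le> hausdorff1_outer A"
proof -
  have bd: "bounded (f ` S)" and diam: "diameter (f ` S) \<le> diameter S" if "bounded S" for S
  proof -
    have le: "dist (f x) (f y) \<le> diameter S" if "x \<in> S" "y \<in> S" for x y
      using lip[of x y] diameter_bounded_bound[OF \<open>bounded S\<close> that] by simp
    then show "bounded (f ` S)"
      by (auto simp: bounded_two_points)
    show "diameter (f ` S) \<le> diameter S"
      using le that by (auto simp: diameter_def[of "f ` S"] diameter_ge_0 intro!: cSUP_least)
  qed
  have "hausdorff1_pre \<delta> (f ` A) \<le> hausdorff1_pre \<delta> A" for \<delta>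
    unfolding hausdorff1_pre_def[of \<delta> A]
  proof (safe intro!: INF_greatest)
    fix E :: "nat \<Rightarrow> 'a set"
    assume cov: "A \<subseteq> (\<Union>i. E i)" and E: "\<forall>i. bounded (E i) \<and> diameter (E i) \<le> \<delta>"
    have "hausdorff1_pre \<delta> (f ` A) \<le> (\<Sum>i. ennreal (diameter (f ` E i)))"
      unfolding hausdorff1_pre_def using image_mono[OF cov, of f] E bd
      by (intro INF_lower) (auto simp: image_UN intro: order_trans[OF diam])
    also have "\<dots> \<le> (\<Sum>i. ennreal (diameter (E i)))"
      using E by (intro suminf_le ennreal_leI diam) auto
    finally show "hausdorff1_pre \<delta> (f ` A) \<le> (\<Sum>i. ennreal (diameter (E i)))" .
  qed
  then show ?thesis
    unfolding hausdorff1_outer_def by (intro SUP_mono) auto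
qed

text \<open>
  Equality holds as well, but only this direction is used: a set of diameter \<open>d\<close> lies in an interval
  of length \<open>d\<close>, so the diameters in a cover of \<open>B\<close> add up to at least its Lebesgue measure.
\<close>

lemma emeasure_lborel_le_hausdorff1_outer:
  fixes B :: "real set"
  assumes "B \<in> sets borel"
  shows "emeasure lborel B \<le> hausdorff1_outer B"
proof -
  have "emeasure lborel B \<le> hausdorff1_pre 1 B"
    unfolding hausdorff1_pre_def
  proof (safe intro!: INF_greatest)
    fix E :: "nat \<Rightarrow> real set"
    assume cov: "B \<subseteq> (\<Union>i. E i)" and E: "\<forall>i. bounded (E i) \<and> diameter (E i) \<le> 1"
    have "\<exists>c. E i \<subseteq> {c..c + diameter (E i)}" for i
    proof (cases "E i = {}")
      case False
      have bdd: "bounded (E i)" using E by simp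
      have "E i \<subseteq> {Inf (E i)..Inf (E i) + diameter (E i)}"
      proof
        fix x assume x: "x \<in> E i"
        have "x - diameter (E i) \<le> Inf (E i)"
          using diameter_bounded_bound[OF bdd x] False
          by (intro cInf_greatest) (auto simp: dist_real_def abs_le_iff algebra_simps)
        with x bdd show "x \<in> {Inf (E i)..Inf (E i) + diameter (E i)}"
          by (auto intro: cInf_lower bounded_imp_bdd_below simp: algebra_simps)
      qed
      then show ?thesis by blast
    qed simp
    then obtain c where c: "\<And>i. E i \<subseteq> {c i..c i + diameter (E i)}" by metis
    have "emeasure lborel B \<le> emeasure lborel (\<Union>i. {c i..c i + diameter (E i)})"
      using cov c by (intro emeasure_mono) fastforce+
    also have "\<dots> \<le> (\<Sum>i. emeasure lborel {c i..c i + diameter (E i)})"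
      by (intro emeasure_subadditive_countably) auto
    also have "\<dots> = (\<Sum>i. ennreal (diameter (E i)))"
      using E by (intro suminf_cong) (simp add: diameter_ge_0)
    finally show "emeasure lborel B \<le> (\<Sum>i. ennreal (diameter (E i)))" .
  qed
  also have "\<dots> \<le> hausdorff1_outer B" by (rule hausdorff1_pre_le_outer) simp
  finally show ?thesis .
qed

text \<open>
  The image of \<^const>\<open>hausdorff1\<close> on \<open>A\<close> under a 1-Lipschitz function dominates Lebesgue measure on
  every Borel subset of the image of \<open>A\<close>. (The image itself need not be Borel.)
\<close>

lemma nn_integral_lipschitz_image_le_hausdorff1:
  fixes \<pi> :: "'a::metric_space \<Rightarrow> real" and g :: "real \<Rightarrow> ennreal"
  assumes lip: "\<And>x y. dist (\<pi> x) (\<pi> y) \<le> dist x y"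
    and [measurable]: "A \<in> sets borel" "B \<in> sets borel" "g \<in> borel_measurable borel"
    and sub: "B \<subseteq> \<pi> ` A"
  shows "(\<integral>\<^sup>+ x \<in> B. g x \<partial>lborel) \<le> (\<integral>\<^sup>+ p \<in> A. g (\<pi> p) \<partial>hausdorff1)"
proof -
  have "continuous_on UNIV \<pi>"
    unfolding continuous_on_iff using lip by (meson le_less_trans)
  then have [measurable]: "\<pi> \<in> borel_measurable borel"
    by (rule borel_measurable_continuous_onI)
  let ?\<mu> = "density lborel (indicator B)"
    and ?\<nu> = "distr (density hausdorff1 (indicator A)) borel \<pi>"
  have le: "emeasure ?\<mu> X \<le> emeasure ?\<nu> X" if [measurable]: "X \<in> sets borel" for X
  proof -
    have pre: "\<pi> -` X \<in> sets borel"
      by (rule measurable_sets_borel) measurable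
    have "emeasure ?\<mu> X = emeasure lborel (B \<inter> X)"
      by (simp add: emeasure_density indicator_inter_arith[symmetric])
    also have "\<dots> \<le> hausdorff1_outer (B \<inter> X)"
      by (rule emeasure_lborel_le_hausdorff1_outer) simp
    also have "\<dots> \<le> hausdorff1_outer (\<pi> ` (\<pi> -` X \<inter> A))"
      using sub by (intro hausdorff1_outer_mono) auto
    also have "\<dots> \<le> hausdorff1_outer (\<pi> -` X \<inter> A)"
      by (rule hausdorff1_outer_lipschitz_image[OF lip])
    also have "\<dots> = emeasure hausdorff1 (\<pi> -` X \<inter> A)"
      using pre by (simp add: emeasure_hausdorff1)
    also have "\<dots> = emeasure ?\<nu> X"
      using pre by (simp add: emeasure_distr emeasure_density indicator_inter_arith[symmetric]
          Int_commute)
    finally show ?thesis .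
  qed
  have "(\<integral>\<^sup>+ x \<in> B. g x \<partial>lborel) = (\<integral>\<^sup>+ x. g x \<partial>?\<mu>)"
    by (simp add: nn_integral_density mult.commute)
  also have "\<dots> \<le> (\<integral>\<^sup>+ x. g x \<partial>?\<nu>)"
  proof (rule nn_integral_mono_measure)
    show "?\<mu> \<le> ?\<nu>"
      using le by (intro le_measure[THEN iffD2]) (auto simp: le_fun_def dest: sets.sets_into_space emeasure_notin_sets)
  qed simp
  also have "\<dots> = (\<integral>\<^sup>+ p \<in> A. g (\<pi> p) \<partial>hausdorff1)"
    by (simp add: nn_integral_distr nn_integral_density mult.commute)
  finally show ?thesis .
qed

section \<open>Exchanging the coordinates\<close>

lemma distr_hausdorff1_swap:
  "distr (hausdorff1 :: ('a::metric_space \<times> 'b::metric_space) measure) borel prod.swap = hausdorff1"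
    (is "?L = _")
proof (rule measure_eqI)
  have cont: "continuous_on UNIV (prod.swap :: 'a \<times> 'b \<Rightarrow> _)"
    by (auto simp: prod.swap_def intro!: continuous_intros)
  then have meas [measurable]: "(prod.swap :: 'a \<times> 'b \<Rightarrow> _) \<in> borel_measurable borel"
    by (rule borel_measurable_continuous_onI)
  fix X assume "X \<in> sets ?L"
  then have X [measurable]: "X \<in> sets borel" by simp
  have pre: "prod.swap -` X \<in> sets borel"
    using measurable_sets[OF meas X] by simp
  have "hausdorff1_outer (prod.swap -` X :: ('a \<times> 'b) set) = hausdorff1_outer X"
  proof (rule antisym)
    have "hausdorff1_outer (prod.swap ` X) \<le> hausdorff1_outer X"
      by (rule hausdorff1_outer_lipschitz_image) (auto simp: dist_prod_def add.commute)
    also have "prod.swap ` X = prod.swap -` X" by force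
    finally show "hausdorff1_outer (prod.swap -` X :: ('a \<times> 'b) set) \<le> hausdorff1_outer X" .
    have "hausdorff1_outer (prod.swap ` (prod.swap -` X :: ('a \<times> 'b) set))
        \<le> hausdorff1_outer (prod.swap -` X :: ('a \<times> 'b) set)"
      by (rule hausdorff1_outer_lipschitz_image) (auto simp: dist_prod_def add.commute)
    also have "prod.swap ` (prod.swap -` X :: ('a \<times> 'b) set) = X" by force
    finally show "hausdorff1_outer X \<le> hausdorff1_outer (prod.swap -` X :: ('a \<times> 'b) set)" .
  qed
  then show "emeasure ?L X = emeasure hausdorff1 X"
    using pre by (simp add: emeasure_distr emeasure_hausdorff1)
qed simp

lemma weight_swap: "weight a b (prod.swap p) = weight b a p"
  by (cases p) (simp add: weight_def mult.commute)

lemma borel_measurable_weight [measurable]: "weight a b \<in> borel_measurable borel"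
  unfolding weight_def borel_prod[symmetric] by measurable

lemma linear_swap: "linear (prod.swap :: 'a::real_vector \<times> 'b::real_vector \<Rightarrow> _)"
  by (auto intro!: linearI simp: prod.swap_def)

lemma distr_lborel_swap: "distr (lborel :: (real \<times> real) measure) borel prod.swap = lborel"
proof -
  have "distr lborel borel prod.swap = distr lborel lborel (\<lambda>(x :: real, y :: real). (y, x))"
    by (intro distr_cong) auto
  also have "\<dots> = lborel"
    using lborel_pair.distr_pair_swap[where ?'a = real and ?'b = real] by (simp add: lborel_prod)
  finally show ?thesis .
qed

lemma nn_integral_weight_swap:
  assumes M: "distr M borel prod.swap = M" and A [measurable]: "A \<in> sets borel"
  shows "(\<integral>\<^sup>+ p \<in> prod.swap ` A. weight b a p \<partial>M) = (\<integral>\<^sup>+ p \<in> A. weight a b p \<partial>M)"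
proof -
  have sets_M [measurable_cong]: "sets M = sets borel"
    using M by (metis sets_distr)
  have meas: "(prod.swap :: real \<times> real \<Rightarrow> _) \<in> borel_measurable borel"
    by (auto simp: prod.swap_def intro!: borel_measurable_continuous_onI continuous_intros)
  then have meas': "prod.swap \<in> M \<rightarrow>\<^sub>M borel"
    by measurable
  have "prod.swap ` A = prod.swap -` A" by force
  then have [measurable]: "prod.swap ` A \<in> sets borel"
    using measurable_sets_borel[OF meas A] by simp
  have "(\<integral>\<^sup>+ p \<in> prod.swap ` A. weight b a p \<partial>M)
      = (\<integral>\<^sup>+ p \<in> prod.swap ` A. weight b a p \<partial>distr M borel prod.swap)"
    by (simp only: M)
  also have "\<dots> = (\<integral>\<^sup>+ p. weight b a (prod.swap p) * indicator (prod.swap ` A) (prod.swap p) \<partial>M)"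
    by (intro nn_integral_distr meas') measurable
  also have "\<dots> = (\<integral>\<^sup>+ p \<in> A. weight a b p \<partial>M)"
    by (intro nn_integral_cong) (auto simp: weight_swap indicator_def)
  finally show ?thesis .
qed

lemma weighted_area_swap:
  "U \<in> sets borel \<Longrightarrow> weighted_area b a (prod.swap ` U) = weighted_area a b U"
  unfolding weighted_area_def by (rule nn_integral_weight_swap[OF distr_lborel_swap])

lemma weighted_perimeter_swap:
  "weighted_perimeter b a (prod.swap ` U) = weighted_perimeter a b U"
proof -
  have "frontier (prod.swap ` U) \<inter> pos_quadrant = prod.swap ` (frontier U \<inter> pos_quadrant)"
    using closure_injective_linear_image[OF linear_swap inj_swap, of U]
      interior_bijective_linear_image[OF linear_swap bij_swap, of U]
    by (force simp: frontier_def)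
  moreover have "frontier U \<inter> pos_quadrant \<in> sets borel"
    by (intro sets.Int borel_closed borel_open open_Times) auto
  ultimately show ?thesis
    unfolding weighted_perimeter_def by (simp add: nn_integral_weight_swap[OF distr_hausdorff1_swap])
qed

section \<open>Staircase domains\<close>

lemma open_lower_set_eq_greaterThanLessThan:
  fixes S :: "real set"
  assumes "open S" "bounded S" "S \<subseteq> {0<..}"
    and lower: "\<And>x y. x \<in> S \<Longrightarrow> 0 < y \<Longrightarrow> y \<le> x \<Longrightarrow> y \<in> S"
  shows "S = {0<..<measure lborel S}"
proof -
  obtain m where m: "S = {0<..<m}" "0 \<le> m"
  proof (cases "S = {}")
    case True
    then show ?thesis using that[of 0] by simp
  next
    case False
    have bdd: "bdd_above S" using \<open>bounded S\<close> by (rule bounded_imp_bdd_above)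
    have "x < Sup S" if x: "x \<in> S" for x
    proof -
      obtain e where e: "e > 0" "ball x e \<subseteq> S"
        using \<open>open S\<close> x open_contains_ball by blast
      then have "x + e/2 \<in> S" by (auto simp: dist_real_def subset_iff)
      then have "x + e/2 \<le> Sup S" using bdd by (rule cSup_upper)
      with e show ?thesis by simp
    qed
    moreover have "x \<in> S" if "0 < x" "x < Sup S" for x
      using that less_cSup_iff[OF False bdd, of x] lower[of _ x] by force
    ultimately have "S = {0<..<Sup S}" using assms(3) by auto
    moreover have "0 \<le> Sup S"
      using False calculation by fastforce
    ultimately show ?thesis by (rule that)
  qed
  then show ?thesis by simp
qed

text \<open>
  Bounded open subsets of the quadrant with property (P). Such a set contains with two points the
  path between them through their coordinatewise minimum, so it is automatically connected.
\<close>

definition staircase :: "(real \<times> real) set \<Rightarrow> bool" where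
  "staircase U \<longleftrightarrow> open U \<and> bounded U \<and> U \<subseteq> pos_quadrant \<and> property_P U"

text \<open>
  The function whose graph bounds \<open>U\<close> from above, as the length of the vertical slice. This is \<open>0\<close>
  on empty slices, and it is a Borel function of \<open>\<sigma>\<close> by the measurability of slice measures.
\<close>

definition height :: "(real \<times> real) set \<Rightarrow> real \<Rightarrow> real" where
  "height U \<sigma> = measure lborel (Pair \<sigma> -` U)"

lemma staircase_lower:
  assumes U: "staircase U" and "(\<sigma>, \<tau>) \<in> U" "0 < \<sigma>'" "\<sigma>' \<le> \<sigma>" "0 < \<tau>'" "\<tau>' \<le> \<tau>"
  shows "(\<sigma>', \<tau>') \<in> U"
proof -
  have P: "slice_fst U \<tau>2 \<subseteq> slice_fst U \<tau>1" "slice_snd U \<tau>2 \<subseteq> slice_snd U \<tau>1"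
    if "0 < \<tau>1" "\<tau>1 \<le> \<tau>2" for \<tau>1 \<tau>2
    using U that unfolding staircase_def property_P_def
    by (metis empty_subsetI order_le_less psubset_imp_subset subset_refl)+
  have "0 < \<sigma>" "0 < \<tau>" using assms by auto
  then have "\<sigma> \<in> slice_fst U \<tau>" using assms by (simp add: slice_fst_def)
  then have "\<sigma> \<in> slice_fst U \<tau>'" using P(1) assms by blast
  then have "\<tau>' \<in> slice_snd U \<sigma>" using assms by (simp add: slice_fst_def slice_snd_def)
  then have "\<tau>' \<in> slice_snd U \<sigma>'" using P(2) assms by blast
  then show ?thesis by (simp add: slice_snd_def)
qed

lemma staircase_swap:
  assumes "staircase U"
  shows "staircase (prod.swap ` U)"
proof -
  have sl: "slice_fst (prod.swap ` U) = slice_snd U" "slice_snd (prod.swap ` U) = slice_fst U"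
    by (force simp: slice_fst_def slice_snd_def fun_eq_iff)+
  have "open (prod.swap ` U)"
    using assms open_bijective_linear_image_eq[OF linear_swap bij_swap, of U]
    by (simp add: staircase_def)
  moreover have "bounded (prod.swap ` U)"
    using assms by (intro bounded_linear_image linear_linear[THEN iffD2] linear_swap)
      (auto simp: staircase_def)
  moreover have "property_P (prod.swap ` U)"
    using assms by (auto simp: staircase_def property_P_def sl)
  moreover have "prod.swap ` U \<subseteq> pos_quadrant"
    using assms by (auto simp: staircase_def)
  ultimately show ?thesis by (simp add: staircase_def)
qed

lemma staircase_slice:
  assumes U: "staircase U"
  shows "Pair \<sigma> -` U = {0<..<height U \<sigma>}"
  unfolding height_def
proof (rule open_lower_set_eq_greaterThanLessThan)
  have "open U" "bounded U" using U by (auto simp: staircase_def)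
  then show "open (Pair \<sigma> -` U)"
    by (intro open_vimage) (auto intro!: continuous_intros)
  show "bounded (Pair \<sigma> -` U)"
    by (rule bounded_subset[OF bounded_snd[OF \<open>bounded U\<close>]]) force
  show "Pair \<sigma> -` U \<subseteq> {0<..}" using U by (auto simp: staircase_def)
  show "y \<in> Pair \<sigma> -` U" if "x \<in> Pair \<sigma> -` U" "0 < y" "y \<le> x" for x y
    using staircase_lower[OF U, of \<sigma> x \<sigma> y] that U by (auto simp: staircase_def)
qed

lemma staircase_iff: "staircase U \<Longrightarrow> (\<sigma>, \<tau>) \<in> U \<longleftrightarrow> 0 < \<tau> \<and> \<tau> < height U \<sigma>"
  using staircase_slice[of U \<sigma>] by (auto simp: set_eq_iff)

lemma height_nonneg: "0 \<le> height U \<sigma>"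
  by (simp add: height_def)

lemma borel_measurable_height [measurable]:
  assumes "open U"
  shows "height U \<in> borel_measurable borel"
proof -
  have "U \<in> sets (lborel \<Otimes>\<^sub>M lborel)"
    using borel_open[OF assms] by (simp only: lborel_prod sets_lborel)
  then have "(\<lambda>\<sigma>. emeasure lborel (Pair \<sigma> -` U)) \<in> borel_measurable lborel"
    by (rule lborel.measurable_emeasure_Pair)
  then show ?thesis
    by (simp add: height_def[abs_def] measure_def)
qed

lemma height_in_frontier:
  assumes U: "staircase U" and h: "0 < height U \<sigma>"
  shows "(\<sigma>, height U \<sigma>) \<in> frontier U"
proof -
  have "{\<sigma>} \<times> {0<..<height U \<sigma>} \<subseteq> U"
    using staircase_iff[OF U] by auto
  then have "closure ({\<sigma>} \<times> {0<..<height U \<sigma>}) \<subseteq> closure U"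
    by (rule closure_mono)
  then have "(\<sigma>, height U \<sigma>) \<in> closure U"
    using h by (auto simp: closure_Times)
  moreover have "(\<sigma>, height U \<sigma>) \<notin> U"
    using staircase_iff[OF U] by auto
  ultimately show ?thesis
    using U by (simp add: staircase_def frontier_def interior_open)
qed

text \<open>
  This is where the strictness in property (P) enters: a second frontier point above \<open>\<sigma>\<close> would give
  a vertical segment in the frontier, along which the horizontal slices of \<open>U\<close> are all equal.
\<close>

lemma frontier_height_eq:
  assumes U: "staircase U" and p: "(\<sigma>, \<tau>) \<in> frontier U" "0 < \<sigma>" "0 < \<tau>"
  shows "\<tau> = height U \<sigma>"
proof (rule ccontr)
  assume "\<tau> \<noteq> height U \<sigma>"
  have "(\<sigma>, \<tau>) \<in> closure U" "(\<sigma>, \<tau>) \<notin> U"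
    using p U by (auto simp: staircase_def frontier_def interior_open)
  then have less: "height U \<sigma> < \<tau>"
    using staircase_iff[OF U] \<open>0 < \<tau>\<close> \<open>\<tau> \<noteq> height U \<sigma>\<close> by force
  have below: "(\<sigma>', \<tau>') \<in> U" if "0 < \<sigma>'" "\<sigma>' < \<sigma>" "0 < \<tau>'" "\<tau>' < \<tau>" for \<sigma>' \<tau>'
  proof -
    have "open ({\<sigma>'<..} \<times> {\<tau>'<..})" by (intro open_Times) auto
    then have "({\<sigma>'<..} \<times> {\<tau>'<..}) \<inter> U \<noteq> {}"
      using \<open>(\<sigma>, \<tau>) \<in> closure U\<close> that open_Int_closure_eq_empty by fastforce
    then obtain x y where "\<sigma>' < x" "\<tau>' < y" "(x, y) \<in> U" by auto
    then show ?thesis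
      using staircase_lower[OF U, of x y \<sigma>' \<tau>'] that by simp
  qed
  have slice: "slice_fst U t = {0<..<\<sigma>}" if t: "height U \<sigma> < t" "t < \<tau>" for t
  proof -
    have "0 < t" using t(1) height_nonneg[of U \<sigma>] by simp
    have "x < \<sigma>" if "0 < x" "(x, t) \<in> U" for x
    proof (rule ccontr)
      assume "\<not> x < \<sigma>"
      then have "(\<sigma>, t) \<in> U"
        using staircase_lower[OF U, of x t \<sigma> t] that \<open>0 < \<sigma>\<close> \<open>0 < t\<close> by simp
      then show False using staircase_iff[OF U] t by simp
    qed
    then show ?thesis
      using below t \<open>0 < t\<close> by (auto simp: slice_fst_def)
  qed
  obtain t1 where t1: "height U \<sigma> < t1" "t1 < \<tau>" using dense[OF less] by auto
  obtain t2 where t2: "t1 < t2" "t2 < \<tau>" using dense[OF t1(2)] by auto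
  have "slice_fst U t2 \<noteq> {}" using slice[of t2] t1 t2 \<open>0 < \<sigma>\<close> by auto
  moreover have "0 < t1" using t1(1) height_nonneg[of U \<sigma>] by simp
  ultimately have "slice_fst U t2 \<subset> slice_fst U t1"
    using U t2(1) by (auto simp: staircase_def property_P_def)
  then show False using slice[of t1] slice[of t2] t1 t2 by simp
qed

section \<open>Area versus perimeter\<close>

lemma nn_integral_powr_from_0:
  fixes b c :: real
  assumes "-1 < b" "0 \<le> c"
  shows "(\<integral>\<^sup>+ x \<in> {0<..<c}. ennreal (x powr b) \<partial>lborel) = ennreal (c powr (b + 1) / (b + 1))"
  using has_integral_powr_from_0[OF assms]
  by (intro nn_integral_has_integral_lebesgue') (auto simp: has_integral_Icc_iff_Ioo)

lemma weighted_area_iterated: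
  assumes [measurable]: "V \<in> sets borel" and V: "V \<subseteq> pos_quadrant"
  shows "weighted_area a b V = (\<integral>\<^sup>+ \<sigma> \<in> {0<..}. ennreal (\<sigma> powr a) *
           (\<integral>\<^sup>+ \<tau> \<in> Pair \<sigma> -` V. ennreal (\<tau> powr b) \<partial>lborel) \<partial>lborel)"
proof -
  have [measurable]: "V \<in> sets (borel \<Otimes>\<^sub>M borel)" "weight a b \<in> borel_measurable (borel \<Otimes>\<^sub>M borel)"
    using assms(1) unfolding borel_prod by simp_all
  have "weighted_area a b V
      = (\<integral>\<^sup>+ \<sigma>. \<integral>\<^sup>+ \<tau>. weight a b (\<sigma>, \<tau>) * indicator V (\<sigma>, \<tau>) \<partial>lborel \<partial>lborel)"
    unfolding weighted_area_def lborel_prod[symmetric]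
    by (subst lborel.nn_integral_fst[symmetric]) measurable
  also have "\<dots> = (\<integral>\<^sup>+ \<sigma> \<in> {0<..}. ennreal (\<sigma> powr a) *
           (\<integral>\<^sup>+ \<tau> \<in> Pair \<sigma> -` V. ennreal (\<tau> powr b) \<partial>lborel) \<partial>lborel)"
  proof (rule nn_integral_cong)
    fix \<sigma> :: real
    have [measurable]: "Pair \<sigma> -` V \<in> sets borel"
      by (rule measurable_sets_borel[of _ borel]) (auto simp: borel_prod[symmetric])
    have "(\<integral>\<^sup>+ \<tau>. weight a b (\<sigma>, \<tau>) * indicator V (\<sigma>, \<tau>) \<partial>lborel)
        = (\<integral>\<^sup>+ \<tau>. (ennreal (\<sigma> powr a) * indicator {0<..} \<sigma>) *
            (ennreal (\<tau> powr b) * indicator (Pair \<sigma> -` V) \<tau>) \<partial>lborel)"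
      using V by (intro nn_integral_cong) (auto simp: weight_def ennreal_mult' indicator_def)
    also have "\<dots> = (ennreal (\<sigma> powr a) * indicator {0<..} \<sigma>) *
        (\<integral>\<^sup>+ \<tau> \<in> Pair \<sigma> -` V. ennreal (\<tau> powr b) \<partial>lborel)"
      by (rule nn_integral_cmult) measurable
    finally show "(\<integral>\<^sup>+ \<tau>. weight a b (\<sigma>, \<tau>) * indicator V (\<sigma>, \<tau>) \<partial>lborel)
        = ennreal (\<sigma> powr a) * (\<integral>\<^sup>+ \<tau> \<in> Pair \<sigma> -` V. ennreal (\<tau> powr b) \<partial>lborel) * indicator {0<..} \<sigma>"
      by (simp add: mult_ac)
  qed
  finally show ?thesis .
qed

lemma nn_integral_height_le_weighted_perimeter:
  assumes U: "staircase U"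
  shows "(\<integral>\<^sup>+ \<sigma> \<in> {\<sigma>. 0 < \<sigma> \<and> 0 < height U \<sigma>}. ennreal (\<sigma> powr a * height U \<sigma> powr b) \<partial>lborel)
    \<le> weighted_perimeter a b U"
proof -
  have [measurable]: "height U \<in> borel_measurable borel"
    using U by (simp add: staircase_def borel_measurable_height)
  let ?\<Gamma> = "frontier U \<inter> pos_quadrant"
  have [measurable]: "?\<Gamma> \<in> sets borel"
    by (intro sets.Int borel_closed borel_open open_Times) auto
  have "(\<integral>\<^sup>+ \<sigma> \<in> {\<sigma>. 0 < \<sigma> \<and> 0 < height U \<sigma>}. ennreal (\<sigma> powr a * height U \<sigma> powr b) \<partial>lborel)
      \<le> (\<integral>\<^sup>+ p \<in> ?\<Gamma>. ennreal (fst p powr a * height U (fst p) powr b) \<partial>hausdorff1)"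
  proof (rule nn_integral_lipschitz_image_le_hausdorff1)
    show "dist (fst x) (fst y) \<le> dist x y" for x y :: "real \<times> real"
      by (rule dist_fst_le)
    show "{\<sigma>. 0 < \<sigma> \<and> 0 < height U \<sigma>} \<subseteq> fst ` ?\<Gamma>"
      using height_in_frontier[OF U] by force
  qed measurable
  also have "\<dots> = weighted_perimeter a b U"
    unfolding weighted_perimeter_def using frontier_height_eq[OF U]
    by (intro nn_integral_cong) (auto simp: weight_def indicator_def)
  finally show ?thesis .
qed

text \<open>
  Comparison of the area of a set with vertical slices \<open>(0, k(\<sigma>))\<close> with the perimeter of \<open>U\<close>,
  by comparing the integrands over \<open>\<sigma>\<close>. For \<open>k \<le> h\<close> the hypothesis holds if \<open>k \<le> s\<close> and \<open>b \<ge> 0\<close>, or,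
  whatever the sign of \<open>b\<close>, if \<open>k = h \<le> s\<close>.
\<close>

lemma weighted_area_le_perimeter:
  assumes U: "staircase U" and b: "-1 < b" and s: "0 \<le> s"
    and V: "V \<in> sets borel" "V \<subseteq> pos_quadrant"
    and slice: "\<And>\<sigma>. 0 < \<sigma> \<Longrightarrow> Pair \<sigma> -` V = {0<..<k \<sigma>}"
    and k: "\<And>\<sigma>. 0 < \<sigma> \<Longrightarrow> 0 < k \<sigma> \<Longrightarrow>
      0 < height U \<sigma> \<and> k \<sigma> powr (b + 1) \<le> s * height U \<sigma> powr b"
  shows "weighted_area a b V \<le> ennreal (s / (b + 1)) * weighted_perimeter a b U"
proof -
  have [measurable]: "height U \<in> borel_measurable borel"
    using U by (simp add: staircase_def borel_measurable_height)
  let ?B = "{\<sigma>. 0 < \<sigma> \<and> 0 < height U \<sigma>}"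
  have slice_le: "(\<integral>\<^sup>+ \<tau> \<in> Pair \<sigma> -` V. ennreal (\<tau> powr b) \<partial>lborel)
      \<le> ennreal (s / (b + 1)) * ennreal (height U \<sigma> powr b) * indicator ?B \<sigma>" if "0 < \<sigma>" for \<sigma>
  proof (cases "0 < k \<sigma>")
    case True
    then have "(\<integral>\<^sup>+ \<tau> \<in> Pair \<sigma> -` V. ennreal (\<tau> powr b) \<partial>lborel) = ennreal (k \<sigma> powr (b + 1) / (b + 1))"
      using nn_integral_powr_from_0[OF b, of "k \<sigma>"] slice[OF \<open>0 < \<sigma>\<close>] by simp
    also have "\<dots> \<le> ennreal (s / (b + 1) * height U \<sigma> powr b)"
      using k[OF \<open>0 < \<sigma>\<close> True] b by (intro ennreal_leI) (simp add: divide_right_mono)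
    finally show ?thesis
      using k[OF \<open>0 < \<sigma>\<close> True] b s \<open>0 < \<sigma>\<close> by (simp add: ennreal_mult[symmetric])
  next
    case False
    then show ?thesis using slice[OF \<open>0 < \<sigma>\<close>] by simp
  qed
  have "weighted_area a b V \<le> (\<integral>\<^sup>+ \<sigma>. ennreal (s / (b + 1)) *
      (ennreal (\<sigma> powr a * height U \<sigma> powr b) * indicator ?B \<sigma>) \<partial>lborel)"
    unfolding weighted_area_iterated[OF V]
  proof (rule nn_integral_mono)
    fix \<sigma> :: real
    show "ennreal (\<sigma> powr a) * (\<integral>\<^sup>+ \<tau> \<in> Pair \<sigma> -` V. ennreal (\<tau> powr b) \<partial>lborel) * indicator {0<..} \<sigma>
        \<le> ennreal (s / (b + 1)) * (ennreal (\<sigma> powr a * height U \<sigma> powr b) * indicator ?B \<sigma>)"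
    proof (cases "0 < \<sigma>")
      case True
      from mult_left_mono[OF slice_le[OF this], of "ennreal (\<sigma> powr a)"] True
      show ?thesis by (simp add: ennreal_mult mult_ac)
    qed simp
  qed
  also have "\<dots> = ennreal (s / (b + 1)) *
      (\<integral>\<^sup>+ \<sigma> \<in> ?B. ennreal (\<sigma> powr a * height U \<sigma> powr b) \<partial>lborel)"
    by (rule nn_integral_cmult) measurable
  also have "\<dots> \<le> ennreal (s / (b + 1)) * weighted_perimeter a b U"
    by (intro mult_left_mono nn_integral_height_le_weighted_perimeter[OF U]) simp
  finally show ?thesis .
qed

lemma weighted_area_low_part_le:
  assumes U: "staircase U" and b: "0 \<le> b" and s: "0 \<le> s"
  shows "weighted_area a b (U \<inter> {p. snd p < s}) \<le> ennreal (s / (b + 1)) * weighted_perimeter a b U"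
proof (rule weighted_area_le_perimeter[OF U _ s, where k = "\<lambda>\<sigma>. min s (height U \<sigma>)"])
  show "U \<inter> {p. snd p < s} \<in> sets borel"
    using U by (intro borel_open open_Int open_Collect_less) (auto simp: staircase_def intro!: continuous_intros)
  show "U \<inter> {p. snd p < s} \<subseteq> pos_quadrant" using U by (auto simp: staircase_def)
  fix \<sigma> :: real
  show "Pair \<sigma> -` (U \<inter> {p. snd p < s}) = {0<..<min s (height U \<sigma>)}"
    using staircase_iff[OF U] by auto
  assume pos: "0 < min s (height U \<sigma>)"
  have "min s (height U \<sigma>) powr (b + 1) = min s (height U \<sigma>) * min s (height U \<sigma>) powr b"
    using pos by (simp add: powr_add mult.commute)
  \<comment> \<open>The factor \<open>min s (height U \<sigma>)\<close> is estimated by \<open>s\<close> and its power by that of the height;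
    the latter needs \<open>0 \<le> b\<close>.\<close>
  also have "\<dots> \<le> s * height U \<sigma> powr b"
    using pos b by (intro mult_mono powr_mono2) auto
  finally show "0 < height U \<sigma> \<and> min s (height U \<sigma>) powr (b + 1) \<le> s * height U \<sigma> powr b"
    using pos by simp
qed (use b in simp)

lemma weighted_area_right_part_le:
  assumes U: "staircase U" and b: "-1 < b" and s: "0 < s" "(s, s) \<notin> U"
  shows "weighted_area a b (U \<inter> {p. s \<le> fst p}) \<le> ennreal (s / (b + 1)) * weighted_perimeter a b U"
proof (rule weighted_area_le_perimeter[OF U b, where k = "\<lambda>\<sigma>. if s \<le> \<sigma> then height U \<sigma> else 0"])
  show "U \<inter> {p. s \<le> fst p} \<in> sets borel"
    using U by (intro sets.Int borel_open borel_closed closed_Collect_le)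
      (auto simp: staircase_def intro!: continuous_intros)
  show "U \<inter> {p. s \<le> fst p} \<subseteq> pos_quadrant" using U by (auto simp: staircase_def)
  fix \<sigma> :: real
  show "Pair \<sigma> -` (U \<inter> {p. s \<le> fst p}) = {0<..<if s \<le> \<sigma> then height U \<sigma> else 0}"
    using staircase_iff[OF U] by auto
  assume "0 < (if s \<le> \<sigma> then height U \<sigma> else 0)"
  then have pos: "0 < height U \<sigma>" "s \<le> \<sigma>" by (auto split: if_splits)
  have "height U \<sigma> \<le> s"
  proof (rule ccontr)
    assume "\<not> height U \<sigma> \<le> s"
    then have "(\<sigma>, s) \<in> U" using staircase_iff[OF U] s by simp
    then show False using staircase_lower[OF U, of \<sigma> s s s] s pos by simp
  qed
  then have "height U \<sigma> * height U \<sigma> powr b \<le> s * height U \<sigma> powr b"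
    by (intro mult_right_mono) auto
  then show "0 < height U \<sigma> \<and>
      (if s \<le> \<sigma> then height U \<sigma> else 0) powr (b + 1) \<le> s * height U \<sigma> powr b"
    using pos by (simp add: powr_add mult.commute)
qed (use s in simp)

lemma weighted_area_square:
  fixes a b s :: real
  assumes "-1 < a" "-1 < b" "0 \<le> s"
  shows "weighted_area a b ({0<..<s} \<times> {0<..<s}) =
    ennreal (s powr (a + 1) / (a + 1) * (s powr (b + 1) / (b + 1)))"
proof -
  have "weighted_area a b ({0<..<s} \<times> {0<..<s}) = (\<integral>\<^sup>+ \<sigma> \<in> {0<..}. ennreal (\<sigma> powr a) *
           (\<integral>\<^sup>+ \<tau> \<in> Pair \<sigma> -` ({0<..<s} \<times> {0<..<s}). ennreal (\<tau> powr b) \<partial>lborel) \<partial>lborel)"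
    by (intro weighted_area_iterated) (auto intro!: borel_open open_Times)
  also have "\<dots> = (\<integral>\<^sup>+ \<sigma>. ennreal (\<sigma> powr a) * indicator {0<..<s} \<sigma> *
      ennreal (s powr (b + 1) / (b + 1)) \<partial>lborel)"
    using nn_integral_powr_from_0[OF assms(2,3)]
    by (intro nn_integral_cong) (auto simp: indicator_def)
  also have "\<dots> = ennreal (s powr (a + 1) / (a + 1)) * ennreal (s powr (b + 1) / (b + 1))"
    using nn_integral_powr_from_0[OF assms(1,3)] by (subst nn_integral_multc) auto
  finally show ?thesis using assms by (simp add: ennreal_mult[symmetric])
qed

text \<open>
  The constant of the isoperimetric inequality. It is symmetric in \<open>a\<close> and \<open>b\<close>.
\<close>

definition isoperimetric_const :: "real \<Rightarrow> real \<Rightarrow> real" where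
  "isoperimetric_const a b =
     ((a + 1) * (b + 1)) powr (1 / (a + b + 2)) * (1 / (a + 1) + 1 / (b + 1))"

lemma isoperimetric_staircase:
  fixes a b :: real
  assumes a: "-1 < a" and b: "0 \<le> b" and U: "staircase U" "U \<noteq> {}"
  defines "D \<equiv> a + b + 2"
  shows "ennreal_powr (weighted_area a b U) ((D - 1) / D)
    \<le> ennreal (isoperimetric_const a b) * weighted_perimeter a b U"
proof -
  have b': "-1 < b" and D: "0 < D" using a b by (auto simp: D_def)
  have oU: "open U" using U by (simp add: staircase_def)
  \<comment> \<open>The diagonal point \<open>(s, s)\<close> is the first one outside \<open>U\<close>.\<close>
  define s where "s = measure lborel {x. (x, x) \<in> U}"
  have diag: "{x. (x, x) \<in> U} = {0<..<s}"
    unfolding s_def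
  proof (rule open_lower_set_eq_greaterThanLessThan)
    have "{x. (x, x) \<in> U} = (\<lambda>x. (x, x)) -` U" by auto
    then show "open {x. (x, x) \<in> U}"
      using oU by (auto intro!: open_vimage continuous_intros)
    show "bounded {x. (x, x) \<in> U}"
      by (rule bounded_subset[OF bounded_fst[of U]]) (use U in \<open>force simp: staircase_def\<close>)+
    show "{x. (x, x) \<in> U} \<subseteq> {0<..}" using U by (auto simp: staircase_def)
  qed (use staircase_lower[OF U(1)] in auto)
  obtain x y where xy: "(x, y) \<in> U" using U by auto
  then have "0 < x" "0 < y" using U by (auto simp: staircase_def)
  then have "(min x y, min x y) \<in> U"
    using staircase_lower[OF U(1) xy] by simp
  then have "min x y \<in> {0<..<s}" using diag by blast
  then have s: "0 < s" by (auto simp: min_def split: if_splits)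
  have "s \<notin> {x. (x, x) \<in> U}" unfolding diag by simp
  then have ss: "(s, s) \<notin> U" by simp
  define P where "P = weighted_perimeter a b U"
  define m where "m = weighted_area a b U"
  define K where "K = 1 / (a + 1) + 1 / (b + 1)"
  have K: "0 < K" using a b by (simp add: K_def add_pos_pos)
  have sub: "{0<..<s} \<times> {0<..<s} \<subseteq> U"
  proof clarify
    fix u v assume "u \<in> {0<..<s}" "v \<in> {0<..<s}"
    moreover from this have "max u v \<in> {x. (x, x) \<in> U}" unfolding diag by auto
    ultimately show "(u, v) \<in> U"
      using staircase_lower[OF U(1), of "max u v" "max u v" u v] by auto
  qed
  have "weighted_area a b ({0<..<s} \<times> {0<..<s}) \<le> m"
    unfolding m_def weighted_area_def using sub
    by (intro nn_integral_mono) (auto simp: indicator_def)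
  moreover have "s powr (a + 1) * s powr (b + 1) = s powr D"
    by (simp add: D_def powr_add[symmetric] algebra_simps)
  ultimately have lower: "ennreal (s powr D / ((a + 1) * (b + 1))) \<le> m"
    using weighted_area_square[OF a b', of s] s by simp
  have "m = weighted_area a b (U \<inter> {p. snd p < s}) + weighted_area a b (U \<inter> {p. s \<le> snd p})"
  proof -
    have [measurable]: "U \<inter> {p. snd p < s} \<in> sets borel" "U \<inter> {p. s \<le> snd p} \<in> sets borel"
      using oU by (auto intro!: sets.Int borel_open[of U] borel_open[OF open_Collect_less]
          borel_closed[OF closed_Collect_le] continuous_intros)
    have "m = (\<integral>\<^sup>+ p. weight a b p * indicator (U \<inter> {p. snd p < s}) p +
        weight a b p * indicator (U \<inter> {p. s \<le> snd p}) p \<partial>lborel)"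
      unfolding m_def weighted_area_def by (intro nn_integral_cong) (auto simp: indicator_def)
    then show ?thesis
      unfolding weighted_area_def by (subst (asm) nn_integral_add) measurable
  qed
  also have "weighted_area a b (U \<inter> {p. snd p < s}) \<le> ennreal (s / (b + 1)) * P"
    unfolding P_def using weighted_area_low_part_le[OF U(1) b] s by simp
  also have "weighted_area a b (U \<inter> {p. s \<le> snd p}) \<le> ennreal (s / (a + 1)) * P"
  proof -
    have eq: "prod.swap ` (U \<inter> {p. s \<le> snd p}) = prod.swap ` U \<inter> {p. s \<le> fst p}" by force
    have meas: "U \<inter> {p. s \<le> snd p} \<in> sets borel"
      using oU by (auto intro!: sets.Int borel_closed[OF closed_Collect_le] continuous_intros)
    have "(s, s) \<notin> prod.swap ` U" using ss by auto
    from weighted_area_right_part_le[OF staircase_swap[OF U(1)] a s this, of b]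
    show ?thesis
      by (simp add: eq[symmetric] weighted_area_swap[OF meas] weighted_perimeter_swap P_def)
  qed
  finally have "m \<le> ennreal (s / (b + 1)) * P + ennreal (s / (a + 1)) * P"
    by (simp add: add_mono)
  also have "\<dots> = ennreal (s * K) * P"
  proof -
    have "s * K = s / (b + 1) + s / (a + 1)" by (simp add: K_def algebra_simps)
    then show ?thesis using a b s by (simp add: distrib_right)
  qed
  finally have upper: "m \<le> ennreal (s * K) * P" .
  define C where "C = isoperimetric_const a b"
  have C: "0 < C" using a b K by (auto simp: C_def isoperimetric_const_def K_def)
  show "ennreal_powr m ((D - 1) / D) \<le> ennreal C * P"
  proof (cases "P = \<infinity>")
    case True
    then show ?thesis using C by (simp add: ennreal_mult_top)
  next
    case False
    then obtain p where p: "0 \<le> p" "P = ennreal p" by (cases P) auto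
    have "m \<le> ennreal (s * K * p)"
      using upper p s K by (simp add: ennreal_mult)
    then obtain \<mu> where \<mu>: "0 \<le> \<mu>" "m = ennreal \<mu>" "\<mu> \<le> s * K * p"
      using p s K by (cases m) (auto simp: top_unique)
    have sD: "s powr D \<le> (a + 1) * (b + 1) * \<mu>"
      using lower \<mu> a b by (simp add: divide_le_eq mult_ac)
    then have "0 < (a + 1) * (b + 1) * \<mu>"
      using s by (metis less_le_trans powr_gt_zero less_irrefl)
    then have \<mu>0: "0 < \<mu>" using \<mu>(1) by (cases "\<mu> = 0") auto
    have "s = (s powr D) powr (1 / D)" using s D by (simp add: powr_powr)
    also have "\<dots> \<le> ((a + 1) * (b + 1) * \<mu>) powr (1 / D)"
      using sD D by (intro powr_mono2) auto
    also have "\<dots> = ((a + 1) * (b + 1)) powr (1 / D) * \<mu> powr (1 / D)"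
      using a b \<mu>0 by (simp add: powr_mult)
    finally have "s \<le> ((a + 1) * (b + 1)) powr (1 / D) * \<mu> powr (1 / D)" .
    then have "s * (K * p) \<le> ((a + 1) * (b + 1)) powr (1 / D) * \<mu> powr (1 / D) * (K * p)"
      using K p by (intro mult_right_mono) auto
    with \<mu>(3) have le: "\<mu> \<le> C * p * \<mu> powr (1 / D)"
      by (simp add: C_def isoperimetric_const_def D_def[symmetric] K_def[symmetric] mult_ac)
    have "(D - 1) / D = 1 - 1 / D" using D by (simp add: diff_divide_distrib)
    then have "\<mu> powr ((D - 1) / D) = \<mu> / \<mu> powr (1 / D)"
      using \<mu>0 by (simp add: powr_diff)
    also have "\<dots> \<le> C * p" using le \<mu>0 by (simp add: divide_le_eq)
    finally show ?thesis
      using \<mu> p C by (simp add: ennreal_powr_def ennreal_mult[symmetric] ennreal_leI)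
  qed
qed

theorem proposition4p1:
  fixes a b D :: real
  assumes "a > -1" and "b > -1" and "a > 0 \<or> b > 0" and "D = a + b + 2"
  shows "\<exists>C::real. C > 0 \<and>
    (\<forall>U :: (real \<times> real) set.
       open U \<longrightarrow> connected U \<longrightarrow> U \<noteq> {} \<longrightarrow> bounded U \<longrightarrow> U \<subseteq> pos_quadrant \<longrightarrow> property_P U \<longrightarrow>
       ennreal_powr (weighted_area a b U) ((D - 1) / D) \<le> ennreal C * weighted_perimeter a b U)"
proof (intro exI[of _ "isoperimetric_const a b"] conjI allI impI)
  show "0 < isoperimetric_const a b"
    using assms by (auto simp: isoperimetric_const_def intro!: mult_pos_pos add_pos_pos)
next
  fix U :: "(real \<times> real) set"
  assume "open U" "U \<noteq> {}" "bounded U" "U \<subseteq> pos_quadrant" "property_P U"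
  then have U: "staircase U" "U \<noteq> {}" "U \<in> sets borel" by (auto simp: staircase_def)
  show "ennreal_powr (weighted_area a b U) ((D - 1) / D)
    \<le> ennreal (isoperimetric_const a b) * weighted_perimeter a b U"
  proof (cases "0 < b")
    case True
    then show ?thesis
      using isoperimetric_staircase[of a b U] assms U by simp
  next
    case False
    then have "0 < a" using assms by simp
    have C: "isoperimetric_const b a = isoperimetric_const a b" and D: "b + a + 2 = D"
      using assms by (simp_all add: isoperimetric_const_def algebra_simps)
    have "ennreal_powr (weighted_area b a (prod.swap ` U)) ((b + a + 2 - 1) / (b + a + 2))
        \<le> ennreal (isoperimetric_const b a) * weighted_perimeter b a (prod.swap ` U)"
      using assms \<open>0 < a\<close> U by (intro isoperimetric_staircase staircase_swap) auto
    then show ?thesis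
      by (simp only: C D weighted_area_swap[OF U(3)] weighted_perimeter_swap)
  qed
qed

end
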